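(* Let $\{\lambda_n\}_{n=1}^\infty$ be a sequence of nonzero complex numbers for which there exist $\alpha_0,\beta_0\in(0,1)$ such that $$\Re(\lambda_n)\ge \beta_0|\lambda_n|\quad\forall n\in\mathbb N,\qquad \sum_{n=1}^\infty\frac{1}{|\lambda_n|^{\alpha_0}}<\infty ,$$ and suppose that $$f(z)=\prod_{n=1}^\infty\left(1+\frac{z}{\lambda_n}\right)=\sum_{n=0}^\infty a_nz^n,\qquad a_0=1,\ a_n>0\ \ \forall n\in\mathbb N .$$ Let $\{m_k\}_{k=0}^\infty$ be defined by $$\frac{f'(0)}{z}-\frac{f'(z)}{zf(z)}=\sum_{k=0}^\infty m_k(-z)^k,\qquad |z|<1 .$$ Then $$m_k=\frac{(-1)^k}{k!}\frac{d^k}{dx^k}\left(\frac{f'(0)}{x}-\frac{f'(x)}{xf(x)}\right)\bigg|_{x=0}=\frac{(-1)^{k+1}}{(k+1)!}\left(\frac{f'(x)}{f(x)}\right)^{(k+1)}\bigg|_{x=0}=\sum_{n=1}^\infty\frac1{\lambda_n^{k+2}} .$$ If $$\gamma_0=\inf\{\Re(\lambda_n) : n\in\mathbb N\}>1,$$ then the sequence $\{\lambda_n\}_{n=1}^\infty$ is positive (that is, every $\lambda_n$ is a positive real number) if and only if $$(-1)^k\Delta^k m_n=\sum_{j=1}^\infty\frac{1}{\lambda_j^{n+2}}\left(1-\frac1{\lambda_j}\right)^k\ge 0\qquad\forall n,k\in\mathbb N_0 .$$ Furthermore, for any nonnegative integer $\ell$, $$(-1)^\ell m_\ell=\det\begin{pmatrix}1&0&0&0&\dots&a_1^2-2a_2\\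 a_1&1&0&0&\dots&a_1a_2-3a_3\\ a_2&a_1&1&0&\dots&a_1a_3-4a_4\\ a_3&a_2&a_1&1&\dots&a_1a_4-5a_5\\ \vdots&\vdots&\vdots&\vdots&\ddots&\vdots\\ a_\ell&a_{\ell-1}&a_{\ell-2}&a_{\ell-3}&\dots&a_1a_{\ell+1}-(\ell+2)a_{\ell+2}\end{pmatrix}$$ and $$(-1)^\ell m_\ell=a_1a_{\ell+1}-(\ell+2)a_{\ell+2}-\sum_{k=1}^{\ell}m_{\ell-k}(-1)^{\ell-k}a_k .$$
   Context: $\mathbb N=\{1,2,\dots\}$ and $\mathbb N_0=\{0,1,2,\dots\}$. $\Delta$ is the forward difference operator in the index: $\Delta m_n=m_{n+1}-m_n$, so $(-1)^k\Delta^k m_n=\sum_{j=0}^k(-1)^j\binom kj m_{n+j}$. The function $\frac{f'(0)}{x}-\frac{f'(x)}{xf(x)}$ has a removable singularity at $x=0$; its value and derivatives at $0$ are those of its analytic extension. The matrix in the determinant is the $(\ell+1)\times(\ell+1)$ matrix obtained from the lower triangular Toeplitz matrix $(a_{i-j})_{0\le i,j\le\ell}$ (with $a_0=1$ and $a_r=0$ for $r<0$) by replacing its last column with the column whose entries are $a_1a_{i+1}-(i+2)a_{i+2}$, $0\le i\le\ell$. *)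

theory Defs
  imports "HOL-Complex_Analysis.Complex_Analysis" "Jordan_Normal_Form.Determinant"
begin

definition fwd_diff :: "(nat \<Rightarrow> 'a::minus) \<Rightarrow> nat \<Rightarrow> 'a" where
  "fwd_diff m n = m (n + 1) - m n"

(* The quotient has a removable singularity at 0 when f is holomorphic near 0 with f 0 = 1;
   remove_sings gives it its limit there, so values and derivatives at 0 are those of the
   analytic extension.  At points where the quotient is already analytic nothing changes. *)
definition log_deriv_quot :: "(complex \<Rightarrow> complex) \<Rightarrow> complex \<Rightarrow> complex" where
  "log_deriv_quot f = remove_sings (\<lambda>z. deriv f 0 / z - deriv f z / (z * f z))"

(* Lower triangular Toeplitz matrix of a (rows and columns 0..l), last column replaced.
   For l = 0 the only column is the replaced one. *)
definition moment_mat :: "(nat \<Rightarrow> real) \<Rightarrow> nat \<Rightarrow> real mat" where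
  "moment_mat a l = mat (l + 1) (l + 1) (\<lambda>(i, j).
     if j = l then a 1 * a (i + 1) - real (i + 2) * a (i + 2)
     else if j \<le> i then a (i - j) else 0)"

end

theory Submission
  imports Defs "HOL-Real_Asymp.Real_Asymp"
begin

text \<open>The logarithmic derivative of the canonical product is the locally uniform limit of
  \<open>\<Sum>n<N. 1 / (z + lam n)\<close> near 0, so its Taylor coefficients are the power sums of the
  \<open>1 / lam n\<close>. Comparing coefficients in \<open>z * f z * log_deriv_quot f z = a 1 * f z - deriv f z\<close>
  gives the recurrence, a unitriangular Toeplitz system solved by Cramer's rule.

  For the converse of the positivity criterion the Hausdorff moment theorem is avoided. With nodes
  \<open>w j = 1 / lam j\<close>, the functional \<open>p \<mapsto> \<Sum>j. (w j)\<^sup>2 * p (w j)\<close> is nonnegative on the semiring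
  generated by \<open>x\<close>, \<open>1 - x\<close> and the nonnegative constants, hence bounded on every \<open>p\<close> for which
  both \<open>p\<close> and \<open>1 - p\<close> lie there. This forces \<open>\<bar>w j\<bar> + \<bar>1 - w j\<bar> \<le> 1\<close>, so the nodes are real.\<close>

section \<open>Positive combinations of products of \<open>x\<close> and
  \<open>1 - x\<close>\<close>

text \<open>The cone is generated algebraically instead of by positivity on the unit interval: the
  moment hypothesis gives a sign for exactly these generators, wherever the complex nodes
  lie.\<close>

inductive bernstein_cone :: "(complex \<Rightarrow> complex) \<Rightarrow> bool" where
  monom: "c \<ge> 0 \<Longrightarrow> bernstein_cone (\<lambda>x. of_real c * (x ^ i * (1 - x) ^ j))"
| add: "bernstein_cone p \<Longrightarrow> bernstein_cone q \<Longrightarrow> bernstein_cone (\<lambda>x. p x + q x)"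

lemma bernstein_cone_mult:
  assumes "bernstein_cone p" "bernstein_cone q"
  shows "bernstein_cone (\<lambda>x. p x * q x)"
  using assms
proof (induction arbitrary: q)
  case (monom c i j)
  show ?case
    using monom(2)
  proof induction
    case (monom d k l)
    have "(\<lambda>x. of_real (c * d) * (x ^ (i + k) * (1 - x) ^ (j + l))) =
      (\<lambda>x::complex. of_real c * (x ^ i * (1 - x) ^ j) * (of_real d * (x ^ k * (1 - x) ^ l)))"
      by (simp add: power_add mult_ac)
    then show ?case
      using bernstein_cone.monom[of "c * d" "i + k" "j + l"] monom \<open>c \<ge> 0\<close> by simp
  next
    case (add p q)
    then show ?case
      using bernstein_cone.add[OF add.IH] by (simp add: distrib_left)
  qed
next
  case (add p p')
  then show ?case
    using bernstein_cone.add[OF add.IH(1)[OF add.prems] add.IH(2)[OF add.prems]]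
    by (simp add: distrib_right)
qed

lemma bernstein_cone_0: "bernstein_cone (\<lambda>x. 0)"
  using bernstein_cone.monom[of 0 0 0] by simp

lemma bernstein_cone_1: "bernstein_cone (\<lambda>x. 1)"
  using bernstein_cone.monom[of 1 0 0] by simp

lemma bernstein_cone_sum:
  "(\<And>i. i \<in> I \<Longrightarrow> bernstein_cone (p i)) \<Longrightarrow> bernstein_cone (\<lambda>x. \<Sum>i\<in>I. p i x)"
  by (induction I rule: infinite_finite_induct)
    (auto intro: bernstein_cone_0 bernstein_cone.add)

text \<open>Algebraic substitute for \<open>0 \<le> p \<le> 1\<close>: if a functional is
  nonnegative on the cone, it is at most its value at the constant 1 on such
  \<open>p\<close>.\<close>

definition bernstein_unit :: "(complex \<Rightarrow> complex) \<Rightarrow> bool" where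
  "bernstein_unit p \<longleftrightarrow> bernstein_cone p \<and> bernstein_cone (\<lambda>x. 1 - p x)"

lemma bernstein_unit_1: "bernstein_unit (\<lambda>x. 1)"
  by (simp add: bernstein_unit_def bernstein_cone_0 bernstein_cone_1)

lemma bernstein_unit_id: "bernstein_unit (\<lambda>x. x)"
  using bernstein_cone.monom[of 1 1 0] bernstein_cone.monom[of 1 0 1]
  by (simp add: bernstein_unit_def)

text \<open>Follows from 1 - pq = (1 - p) + p(1 - q). Closure under powers is what later gives
  bounds uniform in the exponent.\<close>

lemma bernstein_unit_mult:
  assumes "bernstein_unit p" "bernstein_unit q"
  shows "bernstein_unit (\<lambda>x. p x * q x)"
proof -
  have "(\<lambda>x. 1 - p x * q x) = (\<lambda>x. (1 - p x) + p x * (1 - q x))"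
    by (simp add: algebra_simps)
  then show ?thesis
    using assms by (auto simp: bernstein_unit_def intro!: bernstein_cone.add bernstein_cone_mult)
qed

lemma bernstein_unit_power:
  "bernstein_unit p \<Longrightarrow> bernstein_unit (\<lambda>x. p x ^ n)"
  by (induction n) (auto intro: bernstein_unit_1 bernstein_unit_mult)

text \<open>The Bernstein basis of degree \<open>n\<close> sums to 1, so the complement of one
  member is the sum of the others.\<close>

lemma bernstein_unit_basis:
  assumes "k \<le> n"
  shows "bernstein_unit (\<lambda>x. of_nat (n choose k) * (x ^ k * (1 - x) ^ (n - k)))"
proof -
  let ?b = "\<lambda>k x. of_nat (n choose k) * (x ^ k * (1 - x) ^ (n - k)) :: complex"
  have b: "bernstein_cone (?b k)" for k
    using bernstein_cone.monom[of "real (n choose k)" k "n - k"] by simp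
  have "1 - ?b k x = (\<Sum>i\<in>{..n} - {k}. ?b i x)" for x
  proof -
    have "(\<Sum>i\<le>n. ?b i x) = (x + (1 - x)) ^ n"
      unfolding binomial_ring by (simp add: mult_ac)
    then show ?thesis
      using assms by (simp add: sum_diff1)
  qed
  then have "(\<lambda>x. 1 - ?b k x) = (\<lambda>x. \<Sum>i\<in>{..n} - {k}. ?b i x)"
    by auto
  then show ?thesis
    using b bernstein_cone_sum[of "{..n} - {k}" ?b] by (simp add: bernstein_unit_def)
qed

text \<open>The power (a + b)^n outgrows its number \<open>n + 1\<close> of binomial terms, so some
  term exceeds 1. The term with \<open>k = 0\<close> cannot, as \<open>b \<le> 1\<close>; a positive
  \<open>k\<close> later makes the basis polynomial vanish at 0, the limit of the nodes.\<close>

lemma exists_large_binomial_term: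
  fixes a b :: real
  assumes "0 \<le> a" "0 \<le> b" "b \<le> 1" "a + b > 1"
  obtains n k where "0 < k" "k \<le> n" "real (n choose k) * (a ^ k * b ^ (n - k)) > 1"
proof -
  have "eventually (\<lambda>n. (a + b) ^ n > real n + 1) at_top"
    using assms(4) by real_asymp
  then obtain n where n: "(a + b) ^ n > real n + 1"
    using eventually_happens'[OF sequentially_bot] by blast
  have "\<exists>k\<le>n. real (n choose k) * (a ^ k * b ^ (n - k)) > 1"
  proof (rule ccontr)
    assume "\<not> ?thesis"
    then have "(\<Sum>k\<le>n. real (n choose k) * (a ^ k * b ^ (n - k))) \<le> (\<Sum>k\<le>n. 1)"
      by (intro sum_mono) (auto simp: not_less)
    moreover have "(\<Sum>k\<le>n. real (n choose k) * (a ^ k * b ^ (n - k))) = (a + b) ^ n"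
      unfolding binomial_ring by (simp add: mult_ac)
    ultimately show False
      using n by simp
  qed
  then obtain k where k: "k \<le> n" "real (n choose k) * (a ^ k * b ^ (n - k)) > 1"
    by blast
  moreover have "k \<noteq> 0"
  proof
    assume "k = 0"
    with k have "b ^ n > 1" by simp
    with assms power_le_one[of b n] show False by simp
  qed
  ultimately show ?thesis
    using that by blast
qed

section \<open>The moment functional and the location of its nodes\<close>

text \<open>The weights \<open>v\<close> and nodes \<open>w\<close> are complex, and only the
  moments are assumed to be nonnegative reals. The two norm bounds keep every x^n (1 - x)^k bounded
  by 1 at the nodes.\<close>

locale hausdorff_positive =
  fixes v w :: "nat \<Rightarrow> complex"
  assumes v_summable: "summable (\<lambda>j. norm (v j))"
    and w_lim: "w \<longlonglongrightarrow> 0"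
    and w_le: "\<And>j. norm (w j) \<le> 1"
    and w_le': "\<And>j. norm (1 - w j) \<le> 1"
    and moments_nonneg: "\<And>n k. (\<Sum>j. v j * (w j ^ n * (1 - w j) ^ k)) \<in> \<real>\<^sub>\<ge>\<^sub>0"
begin

lemma summable_bounded_mult:
  assumes "\<And>j. norm (u j) \<le> K"
  shows "summable (\<lambda>j. norm (v j * u j))"
proof (rule summable_comparison_test')
  show "summable (\<lambda>j. K * norm (v j))"
    using v_summable by (rule summable_mult)
  show "norm (norm (v j * u j)) \<le> K * norm (v j)" for j
    using mult_left_mono[OF assms, of "norm (v j)" j] by (simp add: norm_mult mult_ac)
qed

text \<open>Summability is proved in the same induction because splitting the infinite sum in the
  additive case depends on it.\<close>

lemma functional_nonneg:
  assumes "bernstein_cone p"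
  shows "summable (\<lambda>j. v j * p (w j)) \<and> (\<Sum>j. v j * p (w j)) \<in> \<real>\<^sub>\<ge>\<^sub>0"
  using assms
proof induction
  case (monom c i k)
  have "norm (w j ^ i * (1 - w j) ^ k) \<le> 1" for j
    using w_le[of j] w_le'[of j] by (simp add: norm_mult norm_power mult_le_one power_le_one)
  then have s: "summable (\<lambda>j. v j * (w j ^ i * (1 - w j) ^ k))"
    by (rule summable_norm_cancel[OF summable_bounded_mult])
  have eq: "(\<lambda>j. v j * (of_real c * (w j ^ i * (1 - w j) ^ k))) =
      (\<lambda>j. of_real c * (v j * (w j ^ i * (1 - w j) ^ k)))"
    by (simp add: mult_ac)
  show ?case
    unfolding eq suminf_mult[OF s]
    using summable_mult[OF s] moments_nonneg[of i k] monom
    by (auto intro: nonneg_Reals_mult_I)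
next
  case (add p q)
  then show ?case
    by (auto simp: distrib_left suminf_add[symmetric] intro: summable_add nonneg_Reals_add_I)
qed

text \<open>The values at \<open>p\<close> and at \<open>1 - p\<close> are nonnegative reals that
  add up to the value at 1.\<close>

lemma functional_unit_le:
  assumes "bernstein_unit p"
  shows "norm (\<Sum>j. v j * p (w j)) \<le> norm (\<Sum>j. v j)"
proof -
  let ?L = "\<lambda>p. \<Sum>j. v j * p (w j)"
  have p: "summable (\<lambda>j. v j * p (w j))" "?L p \<in> \<real>\<^sub>\<ge>\<^sub>0"
    and q: "summable (\<lambda>j. v j * (1 - p (w j)))" "?L (\<lambda>x. 1 - p x) \<in> \<real>\<^sub>\<ge>\<^sub>0"
    using assms functional_nonneg by (auto simp: bernstein_unit_def)
  have "?L p + ?L (\<lambda>x. 1 - p x) = (\<Sum>j. v j)"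
    using suminf_add[OF p(1) q(1)] by (simp add: algebra_simps)
  moreover obtain r r' where "?L p = of_real r" "r \<ge> 0" "?L (\<lambda>x. 1 - p x) = of_real r'" "r' \<ge> 0"
    using p(2) q(2) by (auto simp: nonneg_Reals_def)
  ultimately have "(\<Sum>j. v j) = of_real (r + r')" "?L p = of_real r" "0 \<le> r" "0 \<le> r'"
    by auto
  then show ?thesis
    by (simp only: norm_of_real)
qed

text \<open>Were the triangle inequality strict at a node, some Bernstein basis polynomial \<open>h\<close> would
  exceed 1 in modulus there, while positivity bounds the functional on \<open>q * h ^ N\<close> uniformly in
  \<open>N\<close>; taking \<open>q\<close> to vanish at the finitely many other nodes with \<open>\<bar>h\<bar> \<ge> 1\<close> isolates the node.\<close>
lemma node_norm_le:
  assumes nz: "w i \<noteq> 0" and mass: "(\<Sum>j | w j = w i. v j) \<noteq> 0"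
  shows "norm (w i) + norm (1 - w i) \<le> 1"
proof (rule ccontr)
  assume "\<not> ?thesis"
  then obtain n k where k: "0 < k" "k \<le> n"
      and gt: "real (n choose k) * (norm (w i) ^ k * norm (1 - w i) ^ (n - k)) > 1"
    using exists_large_binomial_term[OF norm_ge_zero norm_ge_zero w_le'[of i], of "w i"]
    unfolding not_le by blast
  define h where "h x = of_nat (n choose k) * (x ^ k * (1 - x) ^ (n - k))" for x :: complex
  have h: "bernstein_unit h"
    unfolding h_def using k(2) by (rule bernstein_unit_basis)
  have h_gt: "norm (h (w i)) > 1"
    using gt by (simp add: h_def norm_mult norm_power)
  define J where "J = {j. w j = w i}"
  \<comment> \<open>Since \<open>h\<close> vanishes at the limit 0 of the nodes, only finitely many
    nodes satisfy |h| \<ge> 1. This makes both \<open>J\<close> and \<open>F\<close> finite.\<close>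
  have "(\<lambda>j. h (w j)) \<longlonglongrightarrow> h 0"
    unfolding h_def by (intro tendsto_intros w_lim)
  moreover have "h 0 = 0"
    using k by (simp add: h_def)
  ultimately have "(\<lambda>j. norm (h (w j))) \<longlonglongrightarrow> 0"
    by (intro tendsto_norm_zero) simp
  then have "eventually (\<lambda>j. norm (h (w j)) < 1) sequentially"
    by (rule order_tendstoD) simp
  then obtain j0 where j0: "norm (h (w j)) < 1" if "j \<ge> j0" for j
    by (auto simp: eventually_sequentially)
  have J_sub: "J \<subseteq> {..<j0}"
    using j0 h_gt unfolding J_def by (force simp: not_le[symmetric])
  then have fin_J: "finite J"
    by (rule finite_subset) simp
  define F where "F = {w j |j. norm (h (w j)) \<ge> 1} - {w i}"
  have "F \<subseteq> w ` {..<j0}"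
    using j0 unfolding F_def by (force simp: not_le[symmetric])
  then have fin_F: "finite F"
    by (rule finite_subset) simp
  define q where "q = (\<Prod>c\<in>F. [:- c, 1:])"
  have q_F: "poly q c = 0 \<longleftrightarrow> c \<in> F" for c
    using fin_F by (auto simp: q_def poly_prod)
  \<comment> \<open>The coefficient sum serves twice: it bounds \<open>q\<close> at every node, and
    it bounds the functional on \<open>q * h ^ N\<close>.\<close>
  define K where "K = (\<Sum>s\<le>degree q. norm (poly.coeff q s))"
  have q_le: "norm (poly q x) \<le> K" if "norm x \<le> 1" for x
    unfolding poly_altdef K_def
  proof (rule sum_norm_le)
    show "norm (poly.coeff q s * x ^ s) \<le> norm (poly.coeff q s)" for s
      using that by (simp add: norm_mult norm_power mult_left_le power_le_one)
  qed
  have K0: "K \<ge> 0"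
    by (simp add: K_def sum_nonneg)
  let ?L = "\<lambda>p. \<Sum>j. v j * p (w j)"
  \<comment> \<open>The polynomial \<open>q\<close> itself need not lie in the cone. Expanded by
    coefficients, each x^s h^N is a \<open>bernstein_unit\<close>, so the bound does not depend on
    \<open>N\<close>.\<close>
  have L_le: "norm (?L (\<lambda>x. poly q x * h x ^ N)) \<le> K * norm (\<Sum>j. v j)"
    and L_summable: "summable (\<lambda>j. v j * (poly q (w j) * h (w j) ^ N))" for N
  proof -
    have u: "bernstein_unit (\<lambda>x. x ^ s * h x ^ N)" for s
      by (intro bernstein_unit_mult bernstein_unit_power h bernstein_unit_id)
    have s: "summable (\<lambda>j. v j * (w j ^ s * h (w j) ^ N))" for s
      using functional_nonneg u unfolding bernstein_unit_def by blast
    have eq: "(\<lambda>j. v j * (poly q (w j) * h (w j) ^ N)) =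
        (\<lambda>j. \<Sum>s\<le>degree q. poly.coeff q s * (v j * (w j ^ s * h (w j) ^ N)))"
      by (simp add: poly_altdef sum_distrib_left sum_distrib_right mult_ac)
    show "summable (\<lambda>j. v j * (poly q (w j) * h (w j) ^ N))"
      unfolding eq by (intro summable_sum summable_mult s)
    have "?L (\<lambda>x. poly q x * h x ^ N) =
        (\<Sum>s\<le>degree q. poly.coeff q s * ?L (\<lambda>x. x ^ s * h x ^ N))"
      unfolding eq by (subst suminf_sum) (auto intro!: summable_mult s sum.cong suminf_mult)
    also have "norm \<dots> \<le> (\<Sum>s\<le>degree q. norm (poly.coeff q s) * norm (\<Sum>j. v j))"
      by (intro sum_norm_le)
        (auto simp: norm_mult intro!: mult_left_mono functional_unit_le u)
    finally show "norm (?L (\<lambda>x. poly q x * h x ^ N)) \<le> K * norm (\<Sum>j. v j)"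
      by (simp add: K_def sum_distrib_right)
  qed
  \<comment> \<open>Indices sharing the node \<open>w i\<close> jointly contribute a term of modulus
    \<open>C * norm (h (w i)) ^ N\<close>.\<close>
  define C where "C = norm ((\<Sum>j\<in>J. v j) * poly q (w i))"
  have "C > 0"
    using mass q_F[of "w i"] by (simp add: C_def J_def F_def)
  define B where "B = K * norm (\<Sum>j. v j) + (\<Sum>j. K * norm (v j))"
  \<comment> \<open>Outside \<open>J\<close> each term either vanishes because of \<open>q\<close>
    or has |h| < 1, so the remainder is dominated by the series of \<open>K * norm (v j)\<close>. A
    geometric sequence with ratio above 1 thus stays bounded, which is absurd.\<close>
  have bound: "C * norm (h (w i)) ^ N \<le> B" for N
  proof -
    let ?t = "\<lambda>j. v j * (poly q (w j) * h (w j) ^ N)"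
    let ?r = "\<lambda>j. if j \<in> J then 0 else ?t j"
    have "(\<lambda>j. if j \<in> J then ?t j else 0) sums (\<Sum>j\<in>J. ?t j)"
      by (rule sums_If_finite_set[OF fin_J])
    then have "(\<lambda>j. ?t j - (if j \<in> J then ?t j else 0)) sums (suminf ?t - (\<Sum>j\<in>J. ?t j))"
      by (intro sums_diff summable_sums L_summable)
    moreover have "(\<lambda>j. ?t j - (if j \<in> J then ?t j else 0)) = ?r"
      by auto
    ultimately have r: "suminf ?r = suminf ?t - (\<Sum>j\<in>J. ?t j)"
      by (simp add: sums_iff)
    have "norm (?r j) \<le> K * norm (v j)" for j
    proof (cases "j \<in> J \<or> w j \<in> F")
      case True
      then show ?thesis
        using K0 q_F[of "w j"] by auto
    next
      case False
      then have "norm (h (w j)) < 1"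
        unfolding F_def J_def by (force simp: not_le[symmetric])
      then have "norm (poly q (w j)) * norm (h (w j)) ^ N \<le> K * 1"
        by (intro mult_mono q_le w_le K0 power_le_one) auto
      then have "norm (v j) * (norm (poly q (w j)) * norm (h (w j)) ^ N) \<le> norm (v j) * K"
        by (intro mult_left_mono) auto
      then show ?thesis
        using False by (simp add: norm_mult norm_power mult_ac)
    qed
    then have "norm (suminf ?r) \<le> (\<Sum>j. K * norm (v j))"
      by (rule norm_suminf_le) (intro summable_mult v_summable)
    moreover have "(\<Sum>j\<in>J. v j) * poly q (w i) * h (w i) ^ N = suminf ?t - suminf ?r"
      unfolding r by (simp add: J_def sum_distrib_right mult.assoc)
    ultimately have "norm ((\<Sum>j\<in>J. v j) * poly q (w i) * h (w i) ^ N) \<le> B"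
      using L_le[of N] norm_triangle_ineq4[of "suminf ?t" "suminf ?r"]
      unfolding B_def by simp
    then show ?thesis
      by (simp add: C_def norm_mult norm_power)
  qed
  obtain N where "B / C < norm (h (w i)) ^ N"
    using real_arch_pow[OF h_gt] by blast
  then show False
    using bound[of N] \<open>C > 0\<close> by (simp add: field_simps)
qed

end

section \<open>Equality in the triangle inequality, and iterated differences of moments\<close>

text \<open>The real parts of z and 1 - z already sum to 1, and a nonzero imaginary part makes |Re
  z| < |z| strict.\<close>

lemma complex_in_Reals_if_norm_le:
  fixes z :: complex
  assumes "norm z + norm (1 - z) \<le> 1"
  shows "z \<in> \<real>"
proof (rule ccontr)
  assume "z \<notin> \<real>"
  then have "Im z \<noteq> 0"
    by (simp add: complex_is_Real_iff)
  then have "\<bar>Re z\<bar>\<^sup>2 < (norm z)\<^sup>2"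
    by (simp add: cmod_power2)
  then have "\<bar>Re z\<bar> < norm z"
    by (rule power_less_imp_less_base) simp
  moreover have "\<bar>1 - Re z\<bar> \<le> norm (1 - z)"
    using abs_Re_le_cmod[of "1 - z"] by simp
  ultimately show False
    using assms by linarith
qed

text \<open>Taking one difference multiplies the j-th term by \<open>w j - 1\<close>; the sign turns
  this into \<open>1 - w j\<close>.\<close>

lemma funpow_fwd_diff_sums:
  fixes m :: "nat \<Rightarrow> complex"
  assumes "\<And>n. (\<lambda>j. v j * w j ^ n) sums m n"
  shows "(\<lambda>j. v j * w j ^ n * (1 - w j) ^ k) sums ((-1) ^ k * (fwd_diff ^^ k) m n)"
proof (induction k arbitrary: n)
  case 0
  then show ?case using assms by simp
next
  case (Suc k)
  have "(\<lambda>j. v j * w j ^ n * (1 - w j) ^ k - v j * w j ^ (n + 1) * (1 - w j) ^ k) sums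
     ((-1) ^ k * (fwd_diff ^^ k) m n - (-1) ^ k * (fwd_diff ^^ k) m (n + 1))"
    by (intro sums_diff Suc)
  then show ?case
    by (simp add: fwd_diff_def[of "(fwd_diff ^^ k) m" n] algebra_simps)
qed

section \<open>The determinant formula\<close>

text \<open>The recurrence for all \<open>i \<le> l\<close> is a linear system for c 0, ..., c l
  with unitriangular Toeplitz matrix \<open>T\<close>. Its right-hand side is the last column of
  \<open>moment_mat a l\<close>, so Cramer's rule for the last unknown, with det T = 1, gives the
  claim.\<close>

lemma det_moment_mat:
  fixes a c :: "nat \<Rightarrow> real"
  assumes a0: "a 0 = 1"
    and rec: "\<And>i. i \<le> l \<Longrightarrow>
      c i = a 1 * a (i + 1) - real (i + 2) * a (i + 2) - (\<Sum>k = 1..i. c (i - k) * a k)"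
  shows "Determinant.det (moment_mat a l) = c l"
proof -
  define T where "T = Matrix.mat (l + 1) (l + 1) (\<lambda>(i, j). if j \<le> i then a (i - j) else 0)"
  define x where "x = Matrix.vec (l + 1) c"
  have T: "T \<in> carrier_mat (l + 1) (l + 1)"
    and x: "x \<in> carrier_vec (l + 1)"
    by (auto simp: T_def x_def)
  have row: "(\<Sum>j = 0..<l + 1. T $$ (i, j) * c j) = a 1 * a (i + 1) - real (i + 2) * a (i + 2)"
    if "i \<le> l" for i
  proof -
    have "(\<Sum>j = 0..<l + 1. T $$ (i, j) * c j) = (\<Sum>j = 0..i. a (i - j) * c j)"
      using that by (intro sum.mono_neutral_cong_right) (auto simp: T_def)
    also have "\<dots> = (\<Sum>k = 0..i. c (i - k) * a k)"
      by (rule sum.reindex_bij_witness[of _ "\<lambda>k. i - k" "\<lambda>k. i - k"]) auto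
    also have "\<dots> = c i * a 0 + (\<Sum>k = 1..i. c (i - k) * a k)"
      by (simp add: sum.atLeast_Suc_atMost)
    finally show ?thesis
      using rec[OF that] a0 by simp
  qed
  have "moment_mat a l = replace_col T (mult_mat_vec T x) l"
  proof (rule eq_matI)
    fix i j
    assume "i < dim_row (replace_col T (mult_mat_vec T x) l)"
      "j < dim_col (replace_col T (mult_mat_vec T x) l)"
    then have ij: "i < l + 1" "j < l + 1"
      using T by (auto simp: replace_col_def)
    have "vec_index (mult_mat_vec T x) i = (\<Sum>j = 0..<l + 1. T $$ (i, j) * c j)"
      using ij T by (simp add: scalar_prod_def x_def)
    then show "moment_mat a l $$ (i, j) = replace_col T (mult_mat_vec T x) l $$ (i, j)"
      using ij T row[of i] by (auto simp: moment_mat_def replace_col_def T_def)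
  qed (use T in \<open>auto simp: moment_mat_def replace_col_def\<close>)
  moreover have "Determinant.det T = 1"
  proof -
    have "Determinant.det T = prod_list (diag_mat T)"
      by (rule det_lower_triangular[OF _ T]) (auto simp: T_def)
    also have "diag_mat T = map (\<lambda>_. 1) [0..<l + 1]"
      unfolding diag_mat_def using T a0 by (auto simp: T_def)
    finally show ?thesis
      by (simp add: map_replicate_const prod_list_replicate)
  qed
  ultimately show ?thesis
    using cramer_lemma_mat[OF T x, of l] by (simp add: x_def)
qed

section \<open>The canonical product and its logarithmic derivative\<close>

lemma prod_one_plus_uniform_limit:
  fixes c :: "nat \<Rightarrow> complex"
  assumes c: "summable (\<lambda>n. norm (c n))"
  shows "uniform_limit (cball 0 R) (\<lambda>N z. \<Prod>n<N. 1 + z * c n) (\<lambda>z. \<Prod>n. 1 + z * c n) sequentially"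
    and "convergent_prod (\<lambda>n. 1 + z * c n)"
proof -
  have conv: "convergent_prod (\<lambda>n. 1 + z * c n)" for z
    using summable_mult[OF c, of "norm z"]
    by (intro abs_convergent_prod_imp_convergent_prod)
      (simp add: abs_convergent_prod_conv_summable norm_mult)
  then show "convergent_prod (\<lambda>n. 1 + z * c n)" .
  have "uniformly_convergent_on (cball 0 R) (\<lambda>N z. \<Sum>n<N. norm (z * c n))"
  proof (rule Weierstrass_m_test')
    show "norm (norm (z * c n)) \<le> R * norm (c n)" if "z \<in> cball 0 R" for n z
      using that by (simp add: norm_mult mult_right_mono)
    show "summable (\<lambda>n. R * norm (c n))"
      using c by (rule summable_mult)
  qed
  then have "uniformly_convergent_on (cball 0 R) (\<lambda>N z. \<Prod>n<N. 1 + z * c n)"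
    by (intro uniformly_convergent_on_prod continuous_intros) auto
  then obtain l where l: "uniform_limit (cball 0 R) (\<lambda>N z. \<Prod>n<N. 1 + z * c n) l sequentially"
    unfolding uniformly_convergent_on_def by blast
  \<comment> \<open>Uniform convergence only provides some limit \<open>l\<close>; uniqueness of
    pointwise limits identifies it with the infinite product.\<close>
  moreover have "l z = (\<Prod>n. 1 + z * c n)" if "z \<in> cball 0 R" for z
  proof (rule LIMSEQ_unique)
    show "(\<lambda>N. \<Prod>n<N. 1 + z * c n) \<longlonglongrightarrow> l z"
      using tendsto_uniform_limitI[OF l that] .
    show "(\<lambda>N. \<Prod>n<N. 1 + z * c n) \<longlonglongrightarrow> (\<Prod>n. 1 + z * c n)"
      using convergent_prod_LIMSEQ[OF conv, of z] LIMSEQ_lessThan_iff_atMost by blast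
  qed
  ultimately show "uniform_limit (cball 0 R) (\<lambda>N z. \<Prod>n<N. 1 + z * c n)
      (\<lambda>z. \<Prod>n. 1 + z * c n) sequentially"
    by (subst uniform_limit_cong'[of _ _ _ _ l]) auto
qed

lemma higher_deriv_one_div_shift:
  fixes b :: complex
  assumes "z + b \<noteq> 0"
  shows "(deriv ^^ k) (\<lambda>z. 1 / (z + b)) z = (-1) ^ k * fact k / (z + b) ^ (k + 1)"
  using assms
proof (induction k arbitrary: z)
  case (Suc k)
  \<comment> \<open>Differentiating the closed form needs it on a neighbourhood of \<open>z\<close>,
    here the complement of the pole.\<close>
  have "eventually (\<lambda>z. z \<in> - {- b}) (nhds z)"
    using Suc.prems by (intro eventually_nhds_in_open) (auto simp: add_eq_0_iff2)
  then have "eventually (\<lambda>z. (deriv ^^ k) (\<lambda>z. 1 / (z + b)) z =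
      (-1) ^ k * fact k / (z + b) ^ (k + 1)) (nhds z)"
    by eventually_elim (use Suc.IH in \<open>auto simp: add_eq_0_iff2\<close>)
  then have "deriv ((deriv ^^ k) (\<lambda>z. 1 / (z + b))) z =
      deriv (\<lambda>z. (-1) ^ k * fact k / (z + b) ^ (k + 1)) z"
    by (rule deriv_cong_ev) simp
  also have "\<dots> = (-1) ^ Suc k * fact (Suc k) / (z + b) ^ (Suc k + 1)"
    using Suc.prems
  proof (intro DERIV_imp_deriv)
    have D: "((\<lambda>z. (z + b) ^ (k + 1)) has_field_derivative of_nat (k + 1) * (z + b) ^ k) (at z)"
    proof -
      have "((\<lambda>z. z + b) has_field_derivative 1) (at z)"
        by (auto intro!: derivative_eq_intros)
      from DERIV_power[OF this, of "k + 1"] show ?thesis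
        by simp
    qed
    have "((\<lambda>z. (-1) ^ k * fact k / (z + b) ^ (k + 1)) has_field_derivative
        - ((-1) ^ k * fact k * (of_nat (k + 1) * (z + b) ^ k)) / ((z + b) ^ (k + 1))\<^sup>2) (at z)"
      by (rule DERIV_divide[OF DERIV_const D, THEN DERIV_cong])
        (use Suc.prems in \<open>simp_all add: power2_eq_square\<close>)
    also have "- ((-1) ^ k * fact k * (of_nat (k + 1) * (z + b) ^ k)) / ((z + b) ^ (k + 1))\<^sup>2 =
        (-1) ^ Suc k * fact (Suc k) / (z + b) ^ (Suc k + 1)"
      using Suc.prems by (simp add: divide_simps power2_eq_square)
    finally show "((\<lambda>z. (-1) ^ k * fact k / (z + b) ^ (k + 1)) has_field_derivative
        (-1) ^ Suc k * fact (Suc k) / (z + b) ^ (Suc k + 1)) (at z)" .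
  qed
  finally show ?case
    by simp
qed simp

text \<open>On a zero-free disc around 0, f'/f is the uniform limit of the sums of 1/(z + lam n), so
  it may be differentiated termwise. The factor (-1)^k / k! cancels the one produced by each
  summand.\<close>

lemma higher_deriv_logderiv_prod:
  fixes lam :: "nat \<Rightarrow> complex"
  assumes nz: "\<And>n. lam n \<noteq> 0" and summ: "summable (\<lambda>n. 1 / norm (lam n))"
    and f: "\<And>z. f z = (\<Prod>n. 1 + z / lam n)"
  shows "(\<lambda>n. 1 / lam n ^ (k + 1)) sums ((-1) ^ k / fact k * (deriv ^^ k) (\<lambda>z. deriv f z / f z) 0)"
proof -
  define c where "c n = 1 / lam n" for n
  have c: "summable (\<lambda>n. norm (c n))"
    using summ by (simp add: c_def norm_divide)
  have f_eq: "f = (\<lambda>z. \<Prod>n. 1 + z * c n)"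
    by (simp add: fun_eq_iff f c_def)
  have "eventually (\<lambda>n. norm (c n) < 1) sequentially"
    using summable_LIMSEQ_zero[OF c] by (rule order_tendstoD) simp
  then obtain n0 where n0: "norm (c n) < 1" if "n \<ge> n0" for n
    by (auto simp: eventually_sequentially)
  \<comment> \<open>A common bound for all |1 / lam n|: the finitely many terms before
    \<open>n0\<close> are covered by their sum, the others by 1.\<close>
  define K where "K = 1 + (\<Sum>n<n0. norm (c n))"
  have "K > 0"
    unfolding K_def by (intro add_pos_nonneg sum_nonneg) auto
  have c_le: "norm (c n) \<le> K" for n
  proof (cases "n < n0")
    case True
    then have "norm (c n) \<le> (\<Sum>n<n0. norm (c n))"
      by (intro member_le_sum) auto
    then show ?thesis by (simp add: K_def)
  next
    case False
    then show ?thesis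
      using n0[of n] sum_nonneg[of "{..<n0}" "\<lambda>n. norm (c n)"] by (simp add: K_def)
  qed
  \<comment> \<open>Every zero of \<open>f\<close> then has distance at least 2d from 0, so |z + lam
    n| \<ge> |lam n| / 2 on the disc of radius \<open>d\<close>. This yields both the absence of
    zeros and the majorant 2 / |lam n|.\<close>
  define d where "d = 1 / (2 * K)"
  have "d > 0"
    using \<open>K > 0\<close> by (simp add: d_def)
  have lam_ge: "2 * d \<le> norm (lam n)" for n
    using c_le[of n] nz[of n] \<open>K > 0\<close> by (simp add: c_def d_def norm_divide field_simps)
  have lower: "norm (lam n) / 2 \<le> norm (z + lam n)" if "z \<in> ball 0 d" for z n
    using that lam_ge[of n] norm_diff_ineq[of "lam n" z] by (simp add: add.commute)
  have nz': "z + lam n \<noteq> 0" if "z \<in> ball 0 d" for z n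
    using lower[OF that, of n] nz[of n] by auto
  have deriv_factor: "deriv (\<lambda>z. 1 + z * c n) z / (1 + z * c n) = 1 / (z + lam n)"
    if "z \<in> ball 0 d" for z n
  proof -
    have "deriv (\<lambda>z. 1 + z * c n) z = c n"
      by (rule DERIV_imp_deriv) (auto intro!: derivative_eq_intros)
    then show ?thesis
      using nz[of n] nz'[OF that, of n] by (simp add: c_def field_simps)
  qed
  have logderiv: "(\<lambda>n. 1 / (z + lam n)) sums (deriv f z / f z)" if z: "z \<in> ball 0 d" for z
  proof -
    have "1 + z * c n \<noteq> 0" for n
      using nz[of n] nz'[OF z, of n] by (auto simp: c_def divide_simps add_ac)
    then have "f z \<noteq> 0"
      unfolding f_eq by (intro prodinf_nonzero prod_one_plus_uniform_limit c)
    moreover have "uniform_limit (ball 0 d) (\<lambda>N z. \<Prod>n<N. 1 + z * c n) f sequentially"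
      unfolding f_eq
      by (rule uniform_limit_on_subset[OF prod_one_plus_uniform_limit(1)[OF c, of d]]) auto
    ultimately have "(\<lambda>n. deriv (\<lambda>z. 1 + z * c n) z / (1 + z * c n)) sums (deriv f z / f z)"
      using z by (intro logderiv_prodinf_complex_uniform_limit) (auto intro!: holomorphic_intros)
    then show ?thesis
      using deriv_factor[OF z] by simp
  qed
  let ?S = "\<lambda>N z. \<Sum>n<N. 1 / (z + lam n)"
  have "uniform_limit (ball 0 d) ?S (\<lambda>z. \<Sum>n. 1 / (z + lam n)) sequentially"
  proof (rule Weierstrass_m_test)
    show "norm (1 / (z + lam n)) \<le> 2 * (1 / norm (lam n))" if "z \<in> ball 0 d" for n z
      using lower[OF that, of n] nz[of n] nz'[OF that, of n] by (simp add: norm_divide field_simps)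
  qed (intro summable_mult summ)
  moreover have "(\<Sum>n. 1 / (z + lam n)) = deriv f z / f z" if "z \<in> ball 0 d" for z
    using logderiv[OF that] by (simp add: sums_iff)
  ultimately have "uniform_limit (ball 0 d) ?S (\<lambda>z. deriv f z / f z) sequentially"
    by (subst uniform_limit_cong'[of _ _ _ _ "\<lambda>z. \<Sum>n. 1 / (z + lam n)"]) auto
  then have "(\<lambda>N. (deriv ^^ k) (?S N) 0) \<longlonglongrightarrow> (deriv ^^ k) (\<lambda>z. deriv f z / f z) 0"
    using \<open>d > 0\<close> nz'
    by (intro higher_deriv_complex_uniform_limit[where A = "ball 0 d"] always_eventually)
      (auto intro!: holomorphic_intros)
  moreover have "(deriv ^^ k) (?S N) 0 = (\<Sum>n<N. (-1) ^ k * fact k / lam n ^ (k + 1))" for N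
  proof (induction N)
    case (Suc N)
    have "(deriv ^^ k) (\<lambda>z. ?S N z + 1 / (z + lam N)) 0 =
        (deriv ^^ k) (?S N) 0 + (deriv ^^ k) (\<lambda>z. 1 / (z + lam N)) 0"
      using nz' \<open>d > 0\<close>
      by (intro higher_deriv_add[where S = "ball 0 d"]) (auto intro!: holomorphic_intros)
    then show ?case
      using Suc nz[of N] by (simp add: higher_deriv_one_div_shift)
  qed (simp add: higher_deriv_const)
  ultimately have "(\<lambda>n. (-1) ^ k * fact k / lam n ^ (k + 1)) sums
      (deriv ^^ k) (\<lambda>z. deriv f z / f z) 0"
    by (simp add: sums_def)
  then have "(\<lambda>n. (-1) ^ k / fact k * ((-1) ^ k * fact k / lam n ^ (k + 1))) sums
      ((-1) ^ k / fact k * (deriv ^^ k) (\<lambda>z. deriv f z / f z) 0)"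
    by (rule sums_mult)
  then show ?thesis
    by (simp flip: power_mult_distrib)
qed


section \<open>Nonnegative series and summability of reciprocals\<close>

lemma sums_in_nonneg_Reals:
  fixes t :: "nat \<Rightarrow> complex"
  assumes "t sums s" "\<And>j. t j \<in> \<real>\<^sub>\<ge>\<^sub>0"
  shows "s \<in> \<real>\<^sub>\<ge>\<^sub>0"
proof (rule Lim_in_closed_set[OF closed_nonneg_Reals_complex])
  show "(\<lambda>n. \<Sum>j<n. t j) \<longlonglongrightarrow> s"
    using assms(1) by (simp add: sums_def)
  have "(\<Sum>j<n. t j) \<in> \<real>\<^sub>\<ge>\<^sub>0" for n
    using assms(2) by (induction n) (auto intro: nonneg_Reals_add_I)
  then show "eventually (\<lambda>n. (\<Sum>j<n. t j) \<in> \<real>\<^sub>\<ge>\<^sub>0) sequentially"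
    by simp
qed simp

text \<open>The summands tend to 0, so eventually \<open>x n \<ge> 1\<close>, where lowering the
  exponent from 1 to \<alpha> can only decrease the power.\<close>

lemma summable_inverse_if_summable_inverse_powr:
  fixes x :: "nat \<Rightarrow> real"
  assumes "\<And>n. x n > 0" "\<alpha> > 0" "\<alpha> \<le> 1" and summ: "summable (\<lambda>n. 1 / x n powr \<alpha>)"
  shows "summable (\<lambda>n. 1 / x n)"
proof (rule summable_comparison_test_ev[OF _ summ])
  have "eventually (\<lambda>n. 1 / x n powr \<alpha> < 1) sequentially"
    using summable_LIMSEQ_zero[OF summ] by (rule order_tendstoD) simp
  then show "eventually (\<lambda>n. norm (1 / x n) \<le> 1 / x n powr \<alpha>) sequentially"
  proof eventually_elim
    case (elim n)
    have "1 < x n powr \<alpha>"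
      using elim assms(1)[of n] by (simp add: divide_simps split: if_splits)
    then have "1 \<le> x n"
      using powr_le1[of \<alpha> "x n"] assms(1)[of n] assms(2) by linarith
    then have "x n powr \<alpha> \<le> x n"
      using powr_mono[OF assms(3), of "x n"] by simp
    then show ?case
      using assms(1)[of n] by (simp add: field_simps)
  qed
qed

section \<open>Moments, positivity criterion and recurrence for the given product\<close>

text \<open>The radius \<open>r\<close> is left open because the quotient has poles inside the unit
  disc when some |lam n| < 1. As \<open>m\<close> is complex-valued, nonnegativity is membership in
  \<open>\<real>\<^sub>\<ge>\<^sub>0\<close>, which includes being real.\<close>

theorem theorem2:
  fixes lam :: "nat \<Rightarrow> complex"  (* indices shifted by one: lam n is the (n+1)-st term *)
    and \<alpha>0 \<beta>0 r :: real
    and f :: "complex \<Rightarrow> complex"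
    and a :: "nat \<Rightarrow> real"
    and m :: "nat \<Rightarrow> complex"
  assumes lam_nz: "\<And>n. lam n \<noteq> 0"
    and \<alpha>0: "0 < \<alpha>0" "\<alpha>0 < 1"
    and \<beta>0: "0 < \<beta>0" "\<beta>0 < 1"
    and sector: "\<And>n. Re (lam n) \<ge> \<beta>0 * norm (lam n)"
    and summ: "summable (\<lambda>n. 1 / norm (lam n) powr \<alpha>0)"
    and f_prod: "\<And>z. f z = (\<Prod>n. 1 + z / lam n)"
    and f_series: "\<And>z. (\<lambda>n. complex_of_real (a n) * z ^ n) sums f z"
    and a_0: "a 0 = 1"
    and a_pos: "\<And>n. n \<ge> 1 \<Longrightarrow> a n > 0"
    and r_pos: "r > 0"
    and m_def: "\<And>z. norm z < r \<Longrightarrow> (\<lambda>k. m k * (- z) ^ k) sums log_deriv_quot f z"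
  shows
    "(\<forall>k. m k = (-1) ^ k / fact k * (deriv ^^ k) (log_deriv_quot f) 0
        \<and> m k = (-1) ^ (k + 1) / fact (k + 1) * (deriv ^^ (k + 1)) (\<lambda>x. deriv f x / f x) 0
        \<and> (\<lambda>n. 1 / lam n ^ (k + 2)) sums m k)
     \<and> ((INF n. Re (lam n)) > 1 \<longrightarrow>
          (\<forall>n k. (\<lambda>j. 1 / lam j ^ (n + 2) * (1 - 1 / lam j) ^ k)
                    sums ((-1) ^ k * (fwd_diff ^^ k) m n))
          \<and> ((\<forall>n. lam n \<in> \<real> \<and> Re (lam n) > 0) \<longleftrightarrow>
              (\<forall>n k. (-1) ^ k * (fwd_diff ^^ k) m n \<in> \<real>\<^sub>\<ge>\<^sub>0)))
     \<and> (\<forall>l. (-1) ^ l * m l = complex_of_real (Determinant.det (moment_mat a l)))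
     \<and> (\<forall>l. (-1) ^ l * m l =
            complex_of_real (a 1 * a (l + 1) - real (l + 2) * a (l + 2))
            - (\<Sum>k = 1..l. m (l - k) * (-1) ^ (l - k) * complex_of_real (a k)))"
proof -
  \<comment> \<open>Functional identities near 0 are turned into identities of formal power series.
    The signs in \<open>Q\<close> come from the expansion in powers of -z.\<close>
  define L where "L = (\<lambda>x. deriv f x / f x)"
  define F where "F = Abs_fps (\<lambda>n. complex_of_real (a n))"
  define Q where "Q = Abs_fps (\<lambda>k. (-1) ^ k * m k)"
  define P where "P = fps_expansion L 0"
  have F: "f has_fps_expansion F"
    using f_series by (intro has_fps_expansionI) (auto simp: F_def)
  have Q: "log_deriv_quot f has_fps_expansion Q"
  proof (rule has_fps_expansionI)
    have "eventually (\<lambda>z::complex. z \<in> ball 0 r) (nhds 0)"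
      using r_pos by (intro eventually_nhds_in_open) auto
    then show "eventually (\<lambda>z. (\<lambda>k. fps_nth Q k * z ^ k) sums log_deriv_quot f z) (nhds 0)"
    proof eventually_elim
      case (elim z)
      have "(\<lambda>k. fps_nth Q k * z ^ k) = (\<lambda>k. m k * (- z) ^ k)"
        by (simp add: Q_def fun_eq_iff power_minus[of z] mult_ac)
      then show ?case
        using m_def[of z] elim by simp
    qed
  qed
  have f0: "f 0 = 1"
    by (simp add: f_prod)
  have deriv_f0: "deriv f 0 = complex_of_real (a 1)"
    using fps_nth_fps_expansion[OF F, of 1] by (simp add: F_def)
  have f_holo: "f holomorphic_on ball 0 1"
    using f_series by (intro power_series_holomorphic[where a = "\<lambda>n. complex_of_real (a n)"]) auto
  have f_ana: "f analytic_on {z}" if "z \<in> ball 0 1" for z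
    using f_holo that open_ball unfolding analytic_at by blast
  have "isCont f 0"
    using f_ana[of 0] by (intro analytic_at_imp_isCont) auto
  then have "(f \<longlongrightarrow> f 0) (nhds 0)"
    by (simp only: isCont_def tendsto_at_iff_tendsto_nhds)
  then have "eventually (\<lambda>z. f z \<noteq> 0) (nhds 0)"
    by (rule tendsto_imp_eventually_ne) (simp add: f0)
  moreover have "eventually (\<lambda>z::complex. z \<in> ball 0 1) (nhds 0)"
    by (intro eventually_nhds_in_open) auto
  ultimately have near: "eventually (\<lambda>z. f z \<noteq> 0 \<and> z \<in> ball 0 1) (nhds 0)"
    by (rule eventually_conj)
  have "L analytic_on {0}"
    unfolding L_def using f0 f_ana[of 0] by (intro analytic_intros) auto
  then have P: "L has_fps_expansion P"
    unfolding P_def by (rule analytic_at_imp_has_fps_expansion_0)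
  have PF: "P * F = fps_deriv F"
  proof (rule fps_expansion_unique_complex)
    show "(\<lambda>z. L z * f z) has_fps_expansion P * F"
      by (intro has_fps_expansion_mult P F)
    have "eventually (\<lambda>z. L z * f z = deriv f z) (nhds 0)"
      using near by eventually_elim (simp add: L_def)
    then show "(\<lambda>z. L z * f z) has_fps_expansion fps_deriv F"
      using has_fps_expansion_deriv[OF F] by (subst has_fps_expansion_cong[OF _ refl])
  qed
  \<comment> \<open>Away from 0 the quotient is analytic and \<open>remove_sings\<close> changes
    nothing; at 0 both sides vanish because \<open>f 0 = 1\<close>.\<close>
  have QX: "Q * fps_X = fps_const (deriv f 0) - P"
  proof (rule fps_expansion_unique_complex)
    show "(\<lambda>z. log_deriv_quot f z * z) has_fps_expansion Q * fps_X"
      by (intro has_fps_expansion_mult Q has_fps_expansion_fps_X)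
    have "eventually (\<lambda>z. log_deriv_quot f z * z = deriv f 0 - L z) (nhds 0)"
      using near
    proof eventually_elim
      case (elim z)
      show ?case
      proof (cases "z = 0")
        case True
        then show ?thesis by (simp add: L_def f0)
      next
        case False
        have "(\<lambda>z. deriv f 0 / z - deriv f z / (z * f z)) analytic_on {z}"
          using elim False f_ana[of z] by (intro analytic_intros) auto
        then have "log_deriv_quot f z = deriv f 0 / z - deriv f z / (z * f z)"
          unfolding log_deriv_quot_def by (rule remove_sings_at_analytic)
        then show ?thesis
          using False elim by (simp add: L_def field_simps)
      qed
    qed
    moreover have "(\<lambda>z. deriv f 0 - L z) has_fps_expansion fps_const (deriv f 0) - P"
      by (intro has_fps_expansion_diff has_fps_expansion_const P)
    ultimately show "(\<lambda>z. log_deriv_quot f z * z) has_fps_expansion fps_const (deriv f 0) - P"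
      by (subst has_fps_expansion_cong[OF _ refl])
  qed
  have m_LDQ: "m k = (-1) ^ k / fact k * (deriv ^^ k) (log_deriv_quot f) 0" for k
  proof -
    have "(-1) ^ k * m k = (deriv ^^ k) (log_deriv_quot f) 0 / fact k"
      using fps_nth_fps_expansion[OF Q, of k] by (simp add: Q_def)
    then have "(-1) ^ k * ((-1) ^ k * m k) = (-1) ^ k * ((deriv ^^ k) (log_deriv_quot f) 0 / fact k)"
      by simp
    then show ?thesis
      by (simp flip: mult.assoc power_mult_distrib)
  qed
  have m_L: "m k = (-1) ^ (k + 1) / fact (k + 1) * (deriv ^^ (k + 1)) L 0" for k
  proof -
    \<comment> \<open>The factor \<open>fps_X\<close> shifts the index by one, and at
      \<open>k + 1 > 0\<close> the constant series contributes nothing.\<close>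
    have "fps_nth (Q * fps_X) (k + 1) = fps_nth (fps_const (deriv f 0) - P) (k + 1)"
      by (simp only: QX)
    then have "(-1) ^ k * m k = - ((deriv ^^ (k + 1)) L 0 / fact (k + 1))"
      using fps_nth_fps_expansion[OF P, of "k + 1"] by (simp add: Q_def)
    then have "(-1) ^ k * ((-1) ^ k * m k) = (-1) ^ k * - ((deriv ^^ (k + 1)) L 0 / fact (k + 1))"
      by simp
    then show ?thesis
      by (simp flip: mult.assoc power_mult_distrib)
  qed
  have abs_summ: "summable (\<lambda>n. 1 / norm (lam n))"
    using summable_inverse_if_summable_inverse_powr[of "\<lambda>n. norm (lam n)" \<alpha>0] lam_nz \<alpha>0 summ
    by simp
  have m_sums: "(\<lambda>n. 1 / lam n ^ (k + 2)) sums m k" for k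
    using higher_deriv_logderiv_prod[OF lam_nz abs_summ f_prod, of "k + 1"] m_L[of k]
    by (simp add: L_def)
  have rec: "(-1) ^ l * m l = complex_of_real (a 1 * a (l + 1) - real (l + 2) * a (l + 2))
      - (\<Sum>k = 1..l. m (l - k) * (-1) ^ (l - k) * complex_of_real (a k))" for l
  proof -
    \<comment> \<open>Multiplying \<open>QX\<close> by \<open>F\<close> and using \<open>PF\<close>
      clears the denominator f; the coefficient of index \<open>l + 1\<close> is the
      recurrence.\<close>
    have "fps_X * (Q * F) = fps_const (deriv f 0) * F - fps_deriv F"
    proof -
      have "fps_X * (Q * F) = (Q * fps_X) * F"
        by (simp add: mult_ac)
      also have "\<dots> = fps_const (deriv f 0) * F - P * F"
        unfolding QX by (rule left_diff_distrib)
      finally show ?thesis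
        unfolding PF .
    qed
    then have "fps_nth (fps_X * (Q * F)) (l + 1) =
        fps_nth (fps_const (deriv f 0) * F - fps_deriv F) (l + 1)"
      by simp
    then have "fps_nth (F * Q) l = complex_of_real (a 1 * a (l + 1) - real (l + 2) * a (l + 2))"
      by (simp add: F_def deriv_f0 mult.commute[of Q])
    moreover have "fps_nth (F * Q) l =
        (-1) ^ l * m l + (\<Sum>k = 1..l. m (l - k) * (-1) ^ (l - k) * complex_of_real (a k))"
      by (simp add: fps_mult_nth F_def Q_def a_0 sum.atLeast_Suc_atMost mult_ac)
    ultimately show ?thesis
      by (metis add_diff_cancel_right')
  qed
  define c where "c l = Re ((-1) ^ l * m l)" for l
  \<comment> \<open>The moments are a priori complex. The recurrence with real \<open>a\<close>
    makes them real by strong induction, so the real determinant lemma applies.\<close>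
  have c: "(-1) ^ l * m l = complex_of_real (c l)" for l
  proof (induction l rule: less_induct)
    case (less l)
    have "m (l - k) * (-1) ^ (l - k) * complex_of_real (a k) \<in> \<real>" if "k \<in> {1..l}" for k
      using less[of "l - k"] that by (intro Reals_mult[OF _ Reals_of_real]) (simp add: mult.commute)
    then have "(-1) ^ l * m l \<in> \<real>"
      unfolding rec[of l] by (intro Reals_diff sum_in_Reals Reals_of_real)
    then show ?case
      unfolding c_def by (rule of_real_Re[symmetric])
  qed
  have det: "(-1) ^ l * m l = complex_of_real (Determinant.det (moment_mat a l))" for l
  proof -
    have "c i = a 1 * a (i + 1) - real (i + 2) * a (i + 2) - (\<Sum>k = 1..i. c (i - k) * a k)" for i
    proof -
      have "(\<Sum>k = 1..i. m (i - k) * (-1) ^ (i - k) * complex_of_real (a k)) =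
          complex_of_real (\<Sum>k = 1..i. c (i - k) * a k)"
        by (simp add: c[symmetric] mult_ac)
      then have "complex_of_real (c i) = complex_of_real
          (a 1 * a (i + 1) - real (i + 2) * a (i + 2) - (\<Sum>k = 1..i. c (i - k) * a k))"
        using rec[of i] c[of i] by simp
      then show ?thesis
        by (simp only: of_real_eq_iff)
    qed
    then have "Determinant.det (moment_mat a l) = c l"
      by (intro det_moment_mat a_0)
    then show ?thesis
      by (simp only: c)
  qed
  have moments: "(\<lambda>j. 1 / lam j ^ (n + 2) * (1 - 1 / lam j) ^ k)
      sums ((-1) ^ k * (fwd_diff ^^ k) m n)" for n k
    using funpow_fwd_diff_sums[of "\<lambda>j. 1 / lam j ^ 2" "\<lambda>j. 1 / lam j" m n k] m_sums
    by (simp add: power_divide power2_eq_square mult_ac)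
  have iff: "(\<forall>n. lam n \<in> \<real> \<and> Re (lam n) > 0) \<longleftrightarrow>
      (\<forall>n k. (-1) ^ k * (fwd_diff ^^ k) m n \<in> \<real>\<^sub>\<ge>\<^sub>0)" (is "?pos \<longleftrightarrow> ?mono")
    if inf: "(INF n. Re (lam n)) > 1"
  proof -
    \<comment> \<open>The sector condition bounds the real parts below, without which
      \<open>INF\<close> over the reals would say nothing about individual terms.\<close>
    have "Re (lam n) \<ge> 0" for n
      using sector[of n] \<beta>0 by (meson order_trans mult_nonneg_nonneg norm_ge_zero less_imp_le)
    then have "bdd_below (range (\<lambda>n. Re (lam n)))"
      by (rule bdd_belowI2)
    then have Re_gt: "Re (lam n) > 1" for n
      using inf cINF_lower[of "\<lambda>n. Re (lam n)" UNIV n] by simp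
    show ?thesis
    proof
      assume pos: ?pos
      show ?mono
      proof (intro allI sums_in_nonneg_Reals[OF moments])
        fix n k j
        obtain x where x: "lam j = complex_of_real x" "x > 1"
          using pos Re_gt[of j] by (metis Reals_cases Re_complex_of_real)
        have "1 / lam j ^ (n + 2) * (1 - 1 / lam j) ^ k =
            complex_of_real (1 / x ^ (n + 2) * (1 - 1 / x) ^ k)"
          by (simp add: x)
        moreover have "1 / x ^ (n + 2) * (1 - 1 / x) ^ k \<ge> 0"
          using x by (intro mult_nonneg_nonneg zero_le_power) auto
        ultimately show "1 / lam j ^ (n + 2) * (1 - 1 / lam j) ^ k \<in> \<real>\<^sub>\<ge>\<^sub>0"
          by (simp only: nonneg_Reals_of_real_iff)
      qed
    next
      assume mono: ?mono
      define w where "w j = 1 / lam j" for j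
      have norm_gt: "norm (lam j) > 1" for j
        using Re_gt[of j] complex_Re_le_cmod[of "lam j"] by linarith
      have norm_w: "norm (w j) = 1 / norm (lam j)" for j
        by (simp add: w_def norm_divide)
      have w_lim: "w \<longlonglongrightarrow> 0"
        by (rule tendsto_norm_zero_cancel, unfold norm_w) (rule summable_LIMSEQ_zero[OF abs_summ])
      have w_le: "norm (w j) \<le> 1" for j
        unfolding norm_w using norm_gt[of j] by (subst divide_le_eq_1) linarith
      interpret hausdorff_positive "\<lambda>j. w j ^ 2" w
      proof
        show "summable (\<lambda>j. norm (w j ^ 2))"
        proof (rule summable_comparison_test'[OF abs_summ])
          show "norm (norm (w j ^ 2)) \<le> 1 / norm (lam j)" for j
            unfolding norm_w[symmetric] using mult_left_le[OF w_le[of j] norm_ge_zero[of "w j"]]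
            by (simp add: power2_eq_square norm_mult)
        qed
        show "norm (1 - w j) \<le> 1" for j
        proof -
          \<comment> \<open>With real part above 1, \<open>lam j\<close> is nearer to 1 than to 0;
            dividing by \<open>lam j\<close> puts the node in the unit disc around 1.\<close>
          have "(norm (lam j - 1))\<^sup>2 \<le> (norm (lam j))\<^sup>2"
            unfolding cmod_power2 using Re_gt[of j] by (simp add: power2_eq_square algebra_simps)
          then have "norm (lam j - 1) \<le> norm (lam j)"
            by (rule power2_le_imp_le) simp
          moreover have "1 - w j = (lam j - 1) / lam j"
            using lam_nz[of j] by (simp add: w_def diff_divide_distrib)
          ultimately show ?thesis
            using lam_nz[of j] by (simp add: norm_divide)
        qed
        show "(\<Sum>j. w j ^ 2 * (w j ^ n * (1 - w j) ^ k)) \<in> \<real>\<^sub>\<ge>\<^sub>0" for n k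
        proof -
          have "(\<lambda>j. w j ^ 2 * (w j ^ n * (1 - w j) ^ k)) =
              (\<lambda>j. 1 / lam j ^ (n + 2) * (1 - 1 / lam j) ^ k)"
            by (simp add: w_def power_divide power2_eq_square mult_ac fun_eq_iff)
          then show ?thesis
            using sums_unique[OF moments[of n k]] mono by metis
        qed
      qed (fact w_lim w_le)+
      show ?pos
      proof
        fix i
        have "w i \<noteq> 0"
          using lam_nz by (simp add: w_def)
        \<comment> \<open>Values of \<open>lam\<close> may repeat, but only finitely often since the
          nodes tend to 0. Equal nodes carry equal weights, so the total mass is the multiplicity
          times \<open>w i ^ 2\<close> and cannot cancel.\<close>
        have "eventually (\<lambda>j. norm (w j) < norm (w i)) sequentially"
          using tendsto_norm_zero[OF w_lim] \<open>w i \<noteq> 0\<close> by (intro order_tendstoD) auto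
        then obtain j0 where "norm (w j) < norm (w i)" if "j \<ge> j0" for j
          by (auto simp: eventually_sequentially)
        then have "{j. w j = w i} \<subseteq> {..<j0}"
          by (force simp: not_le[symmetric])
        then have "finite {j. w j = w i}"
          by (rule finite_subset) simp
        moreover have "(\<Sum>j | w j = w i. w j ^ 2) = of_nat (card {j. w j = w i}) * w i ^ 2"
          by simp
        ultimately have "(\<Sum>j | w j = w i. w j ^ 2) \<noteq> 0"
          using \<open>w i \<noteq> 0\<close> by (auto simp: card_eq_0_iff)
        then have "w i \<in> \<real>"
          using \<open>w i \<noteq> 0\<close> by (intro complex_in_Reals_if_norm_le node_norm_le)
        then have "1 / w i \<in> \<real>"
          by (intro Reals_divide) auto
        then show "lam i \<in> \<real> \<and> Re (lam i) > 0"
          using Re_gt[of i] by (simp add: w_def)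
      qed
    qed
  qed
  show ?thesis
    using m_LDQ m_L m_sums moments iff det rec unfolding L_def by blast
qed

end
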